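(* Let $(\bm{q}^n)_{n\ge 0}$, $(\bm{p}^{n-1/2})_{n\ge 0}$, $([\bm{p}]^n)_{n\ge 0}$ be sequences in $\mathbb{R}^{dN}$ generated by the scheme described in the context, in which the time integral of $\nabla V$ along the free-flight trajectory is computed exactly, with time-steps $h_n>0$ (not necessarily constant). Define the pseudo-energy $$\tilde{H}^n := V(\bm{q}^n) + \frac{1}{2}\left(\bm{p}^{n-1/2}\right)^{\mathrm{T}} \bm{M}^{-1} \bm{p}^{n+1/2},\qquad n\ge 0 .$$ Then the scheme exactly conserves $\tilde H^n$, i.e. $\tilde{H}^{n+1}=\tilde{H}^n$ for all $n\ge 0$. Moreover, if the scheme is initialized by $\bm{p}^{-1/2} = \bm{p}(t^0)$, $\bm{q}^0 = \bm{q}(t^0)$, $[\bm{p}]^{0}=\bm{0}$, where $\bm{q}(t^0),\bm{p}(t^0)\in\mathbb{R}^{dN}$ are the given initial position and momentum vectors, then $\tilde{H}^n = H^0$ for all $n\geq 0$, where $H^0:=H(\bm{q}(t^0),\bm{p}(t^0))$.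
   Context: Let $d,N\ge 1$ be integers, let $\bm{M}\in\mathbb{R}^{dN\times dN}$ be a symmetric positive definite (mass) matrix, and let $V\in C^2(\mathbb{R}^{dN};\mathbb{R})$ be the potential energy. The Hamiltonian is $H(\bm{q},\bm{p}) = \frac{1}{2}\bm{p}^{\mathrm{T}} \bm{M}^{-1}\bm{p} + V(\bm{q})$ for $\bm q,\bm p\in\mathbb{R}^{dN}$. Discrete time nodes $t^0<t^1<\cdots$ are given, with $h_n=t^{n+1}-t^n>0$ and $I_n=[t^n,t^{n+1}]$. The scheme at step $n\ge0$ is: knowing $\bm{p}^{n-1/2}$, $\bm{q}^n$ and $[\bm{p}]^n$ (the momentum jump, a vector of $\mathbb{R}^{dN}$), compute $\bm p^{n+1/2}$, $\bm q^{n+1}$, $[\bm p]^{n+1}$ by $$\bm{p}^{n+1/2} = \bm{p}^{n-1/2} + [\bm{p}]^{n},$$ $$\bm{q}^{n+1} = \bm{q}^n + h_n \bm{M}^{-1}\bm{p}^{n+1/2},$$ $$\frac{1}{2} \left([\bm{p}]^{n+1} + [\bm{p}]^{n} \right) = -\int_{I_n} \nabla V(\bm{\hat{q}}^n(t))\, dt,$$ where the free-flight trajectory is $\bm{\hat{q}}^n(t) = \bm{q}^n + (t - t^n)\bm{M}^{-1}\bm{p}^{n+1/2}$ for $t\in I_n$. *)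

theory Defs
  imports "HOL-Analysis.Analysis"
begin

definition sym_pos_def :: "real^'m^'m \<Rightarrow> bool" where
  "sym_pos_def M \<longleftrightarrow> transpose M = M \<and> (\<forall>x. x \<noteq> 0 \<longrightarrow> x \<bullet> (M *v x) > 0)"

definition C2 :: "('a::real_normed_vector \<Rightarrow> 'b::real_normed_vector) \<Rightarrow> bool" where
  "C2 f \<longleftrightarrow>
     (\<exists>(f' :: 'a \<Rightarrow> 'a \<Rightarrow>\<^sub>L 'b) (f'' :: 'a \<Rightarrow> 'a \<Rightarrow>\<^sub>L 'a \<Rightarrow>\<^sub>L 'b).
        (\<forall>x. (f has_derivative blinfun_apply (f' x)) (at x)) \<and>
        (\<forall>x. (f' has_derivative blinfun_apply (f'' x)) (at x)) \<and>
        continuous_on UNIV f'')"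

definition gradient :: "('a::real_inner \<Rightarrow> real) \<Rightarrow> 'a \<Rightarrow> 'a" where
  "gradient f x = (THE D. GDERIV f x :> D)"

lemma gradient_eqI:
  assumes "GDERIV f x :> D"
  shows "gradient f x = D"
  unfolding gradient_def
proof (rule the_equality)
  fix E assume "GDERIV f x :> E"
  then have "(\<lambda>h. h \<bullet> E) = (\<lambda>h. h \<bullet> D)"
    using assms unfolding gderiv_def by (rule has_derivative_unique)
  then show "E = D"
    by (metis vector_eq_ldot)
qed (fact assms)

definition hamiltonian ::
  "real^'m^'m \<Rightarrow> (real^'m \<Rightarrow> real) \<Rightarrow> real^'m \<Rightarrow> real^'m \<Rightarrow> real" where
  "hamiltonian M V q p = 1/2 * (p \<bullet> (matrix_inv M *v p)) + V q"

(* The momenta live at half-integer indices: p n stands for p^(n-1/2), so that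
   p (Suc n) stands for p^(n+1/2); in particular p 0 stands for p^(-1/2).
   The momentum jump [p]^n is J n. *)

definition free_flight ::
  "real^'m^'m \<Rightarrow> (nat \<Rightarrow> real) \<Rightarrow> (nat \<Rightarrow> real^'m) \<Rightarrow> (nat \<Rightarrow> real^'m) \<Rightarrow> nat \<Rightarrow> real \<Rightarrow> real^'m" where
  "free_flight M t q p n s = q n + (s - t n) *\<^sub>R (matrix_inv M *v p (Suc n))"

definition generated_by_scheme ::
  "real^'m^'m \<Rightarrow> (real^'m \<Rightarrow> real) \<Rightarrow> (nat \<Rightarrow> real) \<Rightarrow>
   (nat \<Rightarrow> real^'m) \<Rightarrow> (nat \<Rightarrow> real^'m) \<Rightarrow> (nat \<Rightarrow> real^'m) \<Rightarrow> bool" where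
  "generated_by_scheme M V t q p J \<longleftrightarrow>
     (\<forall>n. p (Suc n) = p n + J n \<and>
          q (Suc n) = q n + (t (Suc n) - t n) *\<^sub>R (matrix_inv M *v p (Suc n)) \<and>
          (1/2) *\<^sub>R (J (Suc n) + J n)
            = - integral {t n..t (Suc n)} (\<lambda>s. gradient V (free_flight M t q p n s)))"

definition pseudo_energy ::
  "real^'m^'m \<Rightarrow> (real^'m \<Rightarrow> real) \<Rightarrow> (nat \<Rightarrow> real^'m) \<Rightarrow> (nat \<Rightarrow> real^'m) \<Rightarrow> nat \<Rightarrow> real" where
  "pseudo_energy M V q p n = V (q n) + 1/2 * (p n \<bullet> (matrix_inv M *v p (Suc n)))"

end

theory Submission
  imports Defs
begin

text \<open>
  During the step from \<open>t n\<close> to \<open>t (Suc n)\<close> the free flight has the constant velocity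
  \<open>v = matrix_inv M *v p (Suc n)\<close>, so by the fundamental theorem of calculus the potential
  changes by the inner product of \<open>v\<close> with the time integral of the gradient
  (\<open>integral_gradient_along_line\<close>). The scheme makes this integral equal to minus the mean of
  the jumps \<open>J n\<close> and \<open>J (Suc n)\<close>; it is essential here that the integral is exact.
  On the kinetic side, with \<open>p n = p (Suc n) - J n\<close> and
  \<open>p (Suc (Suc n)) = p (Suc n) + J (Suc n)\<close>, the two products \<open>p (Suc n) \<bullet> v\<close> cancel, and the
  symmetry of the inverse mass matrix (\<open>inner_matrix_inv_sym_pos_def\<close>) turns what is left
  into the inner product of \<open>v\<close> with the mean of the two jumps. The two changes are opposite.
  When the initial jump vanishes, \<open>p 0 = p (Suc 0)\<close> and the initial pseudo-energy is the
  Hamiltonian itself.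
\<close>

lemma invertible_sym_pos_def:
  fixes M :: "real^'m^'m"
  assumes "sym_pos_def M"
  shows "invertible M"
proof -
  have "x = 0" if "M *v x = 0" for x
    using assms that unfolding sym_pos_def_def by (metis inner_zero_right less_irrefl)
  then show ?thesis
    by (metis invertible_left_inverse matrix_left_invertible_ker)
qed

text \<open>Each vector \<open>z\<close> is \<open>M\<close> applied to \<open>matrix_inv M *v z\<close>, and the symmetric \<open>M\<close> can be
  moved across the inner product; hence the inverse can be moved as well.\<close>

lemma inner_matrix_inv_sym_pos_def:
  fixes M :: "real^'m^'m"
  assumes "sym_pos_def M"
  shows "x \<bullet> (matrix_inv M *v y) = (matrix_inv M *v x) \<bullet> y"
proof -
  let ?W = "matrix_inv M"
  have "M ** ?W = mat 1"
    using someI_ex[OF invertible_sym_pos_def[OF assms, unfolded invertible_def]]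
    by (simp add: matrix_inv_def)
  then have MW: "M *v (?W *v z) = z" for z
    by (simp add: matrix_vector_mul_assoc)
  have "x \<bullet> (?W *v y) = (M *v (?W *v x)) \<bullet> (?W *v y)"
    by (simp add: MW)
  also have "\<dots> = (?W *v x) \<bullet> (transpose M *v (?W *v y))"
    by (metis dot_lmul_matrix inner_commute transpose_matrix_vector transpose_transpose)
  also have "\<dots> = (?W *v x) \<bullet> y"
    using assms by (simp add: sym_pos_def_def MW)
  finally show ?thesis .
qed

text \<open>The gradient is a definite description, so its defining property has to be derived from
  the Frechet derivative; the vector representing the derivative is read off in the
  coordinates of the standard basis. The same formula makes it continuous, since the derivative,
  being differentiable itself, is continuous in the operator norm.\<close>

lemma
  fixes f :: "'a::euclidean_space \<Rightarrow> real"
  assumes "C2 f"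
  shows GDERIV_gradient_C2: "GDERIV f x :> gradient f x"
    and continuous_on_gradient_C2: "continuous_on S (gradient f)"
proof -
  obtain f' :: "'a \<Rightarrow> 'a \<Rightarrow>\<^sub>L real" and f'' :: "'a \<Rightarrow> 'a \<Rightarrow>\<^sub>L 'a \<Rightarrow>\<^sub>L real"
    where f': "\<And>x. (f has_derivative blinfun_apply (f' x)) (at x)"
      and f'': "\<And>x. (f' has_derivative blinfun_apply (f'' x)) (at x)"
    using assms unfolding C2_def by metis
  define G where "G x = (\<Sum>b\<in>Basis. blinfun_apply (f' x) b *\<^sub>R b)" for x
  have "blinfun_apply (f' x) = (\<lambda>h. h \<bullet> G x)" for x
  proof
    fix h
    have "blinfun_apply (f' x) h = blinfun_apply (f' x) (\<Sum>b\<in>Basis. (h \<bullet> b) *\<^sub>R b)"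
      by (simp add: euclidean_representation)
    also have "\<dots> = h \<bullet> G x"
      by (simp add: G_def blinfun.sum_right blinfun.scaleR_right inner_sum_right mult.commute)
    finally show "blinfun_apply (f' x) h = h \<bullet> G x" .
  qed
  then have G: "GDERIV f x :> G x" for x
    using f'[of x] unfolding gderiv_def by simp
  then have grad: "gradient f = G"
    by (auto intro: gradient_eqI)
  show "GDERIV f x :> gradient f x"
    using G grad by simp
  have "continuous_on S f'"
    using f'' by (meson continuous_at_imp_continuous_on has_derivative_continuous)
  then show "continuous_on S (gradient f)"
    unfolding grad G_def by (intro continuous_intros)
qed

text \<open>The chain rule along a line followed by the fundamental theorem of calculus. The constant
  velocity is what allows the inner product to be taken after integrating the gradient.\<close>

lemma integral_gradient_along_line:
  fixes f :: "'a::euclidean_space \<Rightarrow> real"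
  assumes "C2 f" and "a \<le> b"
  shows "v \<bullet> integral {a..b} (\<lambda>s. gradient f (x + (s - a) *\<^sub>R v)) = f (x + (b - a) *\<^sub>R v) - f x"
proof -
  let ?g = "\<lambda>s. x + (s - a) *\<^sub>R v"
  have "continuous_on {a..b} (\<lambda>s. gradient f (?g s))"
    by (rule continuous_on_compose2[OF continuous_on_gradient_C2[OF assms(1), of UNIV]])
      (auto intro!: continuous_intros)
  then have int: "(\<lambda>s. gradient f (?g s)) integrable_on {a..b}"
    by (rule integrable_continuous_real)
  have deriv: "((\<lambda>s. f (?g s)) has_vector_derivative (v \<bullet> gradient f (?g s))) (at s within {a..b})" for s
  proof -
    have "(?g has_derivative (\<lambda>h. h *\<^sub>R v)) (at s within {a..b})"
      by (auto intro!: derivative_eq_intros)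
    moreover have "(f has_derivative (\<lambda>h. h \<bullet> gradient f (?g s))) (at (?g s))"
      using GDERIV_gradient_C2[OF assms(1)] by (simp add: gderiv_def)
    ultimately have "((\<lambda>s. f (?g s)) has_derivative (\<lambda>h. (h *\<^sub>R v) \<bullet> gradient f (?g s)))
        (at s within {a..b})"
      by (rule has_derivative_compose)
    then show ?thesis
      by (simp add: has_vector_derivative_def)
  qed
  have "((\<lambda>s. v \<bullet> gradient f (?g s)) has_integral (f (?g b) - f (?g a))) {a..b}"
    using assms(2) deriv by (rule fundamental_theorem_of_calculus)
  then have "integral {a..b} (\<lambda>s. v \<bullet> gradient f (?g s)) = f (?g b) - f x"
    by (simp add: integral_unique)
  then show ?thesis
    using integral_linear[OF int bounded_linear_inner_right[of v]] by (simp add: o_def)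
qed

lemma pseudo_energy_Suc:
  fixes M :: "real^'m^'m"
  assumes M: "sym_pos_def M" and V: "C2 V" and t: "t n \<le> t (Suc n)"
    and scheme: "generated_by_scheme M V t q p J"
  shows "pseudo_energy M V q p (Suc n) = pseudo_energy M V q p n"
proof -
  define v where "v = matrix_inv M *v p (Suc n)"
  let ?I = "integral {t n..t (Suc n)} (\<lambda>s. gradient V (free_flight M t q p n s))"
  have q': "q (Suc n) = q n + (t (Suc n) - t n) *\<^sub>R v"
    and J: "(1/2) *\<^sub>R (J (Suc n) + J n) = - ?I"
    and p: "p n = p (Suc n) - J n"
    and p'': "p (Suc (Suc n)) = p (Suc n) + J (Suc n)"
    using scheme by (simp_all add: generated_by_scheme_def v_def)
  have "V (q (Suc n)) - V (q n) = v \<bullet> ?I"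
    using integral_gradient_along_line[OF V t, of v "q n"]
    by (simp add: q' free_flight_def v_def)
  also have "?I = - ((1/2) *\<^sub>R (J (Suc n) + J n))"
    by (simp only: J minus_minus)
  also have "v \<bullet> \<dots> = - (1/2) * (v \<bullet> J (Suc n) + v \<bullet> J n)"
    by (simp add: inner_add_right)
  finally have potential: "V (q (Suc n)) - V (q n) = - (1/2) * (v \<bullet> J (Suc n) + v \<bullet> J n)" .
  have "p (Suc n) \<bullet> (matrix_inv M *v p (Suc (Suc n))) = v \<bullet> p (Suc n) + v \<bullet> J (Suc n)"
    by (simp add: inner_matrix_inv_sym_pos_def[OF M] p'' inner_add_right v_def)
  moreover have "p n \<bullet> v = v \<bullet> p (Suc n) - v \<bullet> J n"
    by (simp add: p inner_diff_right inner_commute)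
  ultimately show ?thesis
    using potential by (simp add: pseudo_energy_def v_def[symmetric] field_simps)
qed

theorem theorem1:
  fixes M :: "real^('d::finite \<times> 'N::finite)^('d \<times> 'N)"
    and V :: "real^('d \<times> 'N) \<Rightarrow> real"
    and t :: "nat \<Rightarrow> real"
    and q p J :: "nat \<Rightarrow> real^('d \<times> 'N)"
  assumes "sym_pos_def M"
    and "C2 V"
    and "\<And>n. t n < t (Suc n)"
    and "generated_by_scheme M V t q p J"
  shows "(\<forall>n. pseudo_energy M V q p (Suc n) = pseudo_energy M V q p n) \<and>
         (\<forall>q_init p_init :: real^('d \<times> 'N).
            p 0 = p_init \<and> q 0 = q_init \<and> J 0 = 0 \<longrightarrow>
            (\<forall>n. pseudo_energy M V q p n = hamiltonian M V q_init p_init))"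
proof -
  have const: "\<forall>n. pseudo_energy M V q p (Suc n) = pseudo_energy M V q p n"
    using assms by (blast intro: pseudo_energy_Suc less_imp_le)
  have "pseudo_energy M V q p n = hamiltonian M V (q 0) (p 0)" if "J 0 = 0" for n
  proof (induction n)
    case 0
    have "p (Suc 0) = p 0"
      using assms(4) that by (simp add: generated_by_scheme_def)
    then show ?case
      by (simp add: pseudo_energy_def hamiltonian_def)
  next
    case (Suc n)
    then show ?case
      using const by simp
  qed
  with const show ?thesis
    by blast
qed

end
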